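(* Let $\gamma=\frac{\log 2}{\log 3}$, let $\psi:\{3^n:n\in\mathbb{N}\}\to\{3^{-r}:r\in\mathbb{Z}\}$ be a function, and let $f$ be a dimension function such that $r\mapsto r^{-\gamma}f(r)$ is monotonic. Then $$\mathcal{H}^f(W_{\mathcal{C}}(\psi))=\begin{cases}0 & \text{if } \sum_{n=1}^{\infty} f(\psi(3^n))\,(3^n)^{\gamma}<\infty,\\ \mathcal{H}^f(\mathcal{C}) & \text{if } \sum_{n=1}^{\infty} f(\psi(3^n))\,(3^n)^{\gamma}=\infty.\end{cases}$$
   Context: $\mathbb{F}_3$ is the field with $3$ elements. $\mathbb{F}_3((X^{-1}))$ is the field of formal Laurent series $\sum_{n=-N}^{\infty}a_{-n}X^{-n}$ with $a_{-n}\in\mathbb{F}_3$, with ultrametric absolute value $|0|=0$ and $\left|\sum_{n=-N}^{\infty}a_{-n}X^{-n}\right|=3^N$ when $a_N\neq 0$; it is the completion of $\mathbb{F}_3(X)$ with respect to $|P|=3^{\deg P}$. Let $\mathbb{I}=\{h:|h|<1\}$, i.e. the series of the form $\sum_{n\ge1}a_{-n}X^{-n}$. The Cantor set is $\mathcal{C}=\{\sum_{n\ge 1}a_{-n}X^{-n}\in\mathbb{I}: a_{-n}\in\{0,2\}\text{ for all }n\}$. For $N\in\mathbb{N}=\{1,2,\dots\}$, $\mathcal{F}(N)$ is the set of polynomials $g\in\mathbb{F}_3[X]$ with all coefficients in $\{0,2\}$ and $\deg g<N$ (including $g=0$). Define $$W_{\mathcal{C}}(\psi)=\left\{h\in\mathcal{C}:\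 \text{for infinitely many } N\in\mathbb{N}\text{ there is } g\in\mathcal{F}(N)\text{ with }\left|h-\tfrac{g}{X^N}\right|<\psi(3^N)\right\}.$$ A dimension function is a continuous, non-decreasing function $f:\mathbb{R}_{\ge0}\to\mathbb{R}_{\ge0}$ with $f(0)=0$. Balls are $B(x,3^k)=\{y:|y-x|<3^k\}$, $k\in\mathbb{Z}$; the radius of $B=B(x,3^k)$ is $r(B)=3^k$. For $A\subseteq\mathbb{F}_3((X^{-1}))$, the Hausdorff $f$-measure is $\mathcal{H}^f(A)=\lim_{\rho\to0}\inf\sum_i f(r(B_i))$, the infimum being over all countable covers $\{B_i\}$ of $A$ by balls with $r(B_i)\le\rho$. *)

theory Defs
  imports "HOL-Analysis.Analysis" "HOL-Computational_Algebra.Formal_Laurent_Series"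
begin

text \<open>
  The type \<^typ>\<open>'a fls\<close> represents the field of Laurent series in \<open>1/X\<close>: its formal variable
  \<^const>\<open>fls_X\<close> plays the role of \<open>1/X\<close>, so that \<open>fls_nth h n\<close> is the coefficient of \<open>X powi (- n)\<close>
  and \<^const>\<open>fls_X_inv\<close> is \<open>X\<close>.  The metric that the library puts on \<^typ>\<open>'a fls\<close> uses base 2
  and is not used here.  The definitions make sense over any field and are meant for
  a field with three elements.
\<close>

definition laurent_abs :: "'a::field fls \<Rightarrow> real" where
  "laurent_abs h = (if h = 0 then 0 else 3 powi (- fls_subdegree h))"

definition laurent_of_poly :: "'a::field poly \<Rightarrow> 'a fls" where
  "laurent_of_poly g = poly (map_poly fls_const g) fls_X_inv"

lemma fls_nth_laurent_of_poly:
  "fls_nth (laurent_of_poly g) n = (if n \<le> 0 then coeff g (nat (- n)) else 0)"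
proof (induction g arbitrary: n)
  case 0
  show ?case by (simp add: laurent_of_poly_def)
next
  case (pCons a g)
  have "laurent_of_poly (pCons a g) = fls_const a + fls_X_inv * laurent_of_poly g"
    using pCons.hyps by (simp add: laurent_of_poly_def map_poly_pCons)
  then have "fls_nth (laurent_of_poly (pCons a g)) n
      = (if n = 0 then a else 0) + fls_nth (laurent_of_poly g) (n + 1)"
    by (simp add: fls_X_inv_times_conv_shift)
  also have "\<dots> = (if n \<le> 0 then coeff (pCons a g) (nat (- n)) else 0)"
  proof (cases "n < 0")
    case True
    then have "nat (- n) = Suc (nat (- (n + 1)))" by simp
    then show ?thesis using True pCons.IH[of "n + 1"] by (simp del: nat_minus_as_int)
  next
    case False
    then show ?thesis using pCons.IH[of "n + 1"] by auto
  qed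
  finally show ?case .
qed

lemma laurent_abs_of_poly:
  assumes "g \<noteq> 0"
  shows "laurent_abs (laurent_of_poly g) = 3 ^ degree g"
proof -
  have "fls_subdegree (laurent_of_poly g) = - int (degree g)"
    using assms by (intro fls_subdegree_eqI) (auto simp: fls_nth_laurent_of_poly coeff_eq_0)
  moreover have "fls_nth (laurent_of_poly g) (- int (degree g)) \<noteq> 0"
    using assms by (simp add: fls_nth_laurent_of_poly)
  then have "laurent_of_poly g \<noteq> 0" by auto
  ultimately show ?thesis by (simp add: laurent_abs_def)
qed

definition cantor_set :: "'a::field fls set" where
  "cantor_set = {h. laurent_abs h < 1 \<and> (\<forall>n\<ge>1. fls_nth h n \<in> {0, 2})}"

text \<open>The disjunct \<open>g = 0\<close> accounts for \<^term>\<open>degree 0 = 0\<close> in the library.\<close>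

definition cantor_polys :: "nat \<Rightarrow> 'a::field poly set" where
  "cantor_polys N = {g. (\<forall>i. coeff g i \<in> {0, 2}) \<and> (g = 0 \<or> degree g < N)}"

definition cantor_approximable :: "(real \<Rightarrow> real) \<Rightarrow> 'a::field fls set" where
  "cantor_approximable \<psi> =
     {h \<in> cantor_set. infinite {N. N \<ge> 1 \<and>
        (\<exists>g \<in> cantor_polys N. laurent_abs (h - laurent_of_poly g / fls_X_inv ^ N) < \<psi> (3 ^ N))}}"

definition dimension_function :: "(real \<Rightarrow> real) \<Rightarrow> bool" where
  "dimension_function f \<longleftrightarrow>
     f \<in> {0..} \<rightarrow> {0..} \<and> continuous_on {0..} f \<and> mono_on {0..} f \<and> f 0 = 0"

definition laurent_ball :: "'a::field fls \<Rightarrow> int \<Rightarrow> 'a fls set" where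
  "laurent_ball x k = {y. laurent_abs (y - x) < 3 powi k}"

text \<open>A pair \<open>(x, k)\<close> in a cover stands for the ball with centre \<open>x\<close> and radius \<open>3 powi k\<close>;
  covers may be finite or countably infinite.\<close>

definition ball_covers :: "real \<Rightarrow> 'a::field fls set \<Rightarrow> ('a fls \<times> int) set set" where
  "ball_covers \<rho> A =
     {U. countable U \<and> (\<forall>(x, k)\<in>U. 3 powi k \<le> \<rho>) \<and> A \<subseteq> (\<Union>(x, k)\<in>U. laurent_ball x k)}"

definition hausdorff_premeasure :: "(real \<Rightarrow> real) \<Rightarrow> real \<Rightarrow> 'a::field fls set \<Rightarrow> ennreal" where
  "hausdorff_premeasure f \<rho> A =
     (INF U \<in> ball_covers \<rho> A. \<Sum>\<^sub>\<infinity>(x, k)\<in>U. ennreal (f (3 powi k)))"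

definition hausdorff_measure :: "(real \<Rightarrow> real) \<Rightarrow> 'a::field fls set \<Rightarrow> ennreal" where
  "hausdorff_measure f A = Lim (at_right 0) (\<lambda>\<rho>. hausdorff_premeasure f \<rho> A)"

lemma hausdorff_premeasure_antimono:
  assumes "\<rho> \<le> \<sigma>"
  shows "hausdorff_premeasure f \<sigma> A \<le> hausdorff_premeasure f \<rho> A"
proof -
  have "ball_covers \<rho> A \<subseteq> ball_covers \<sigma> A"
    unfolding ball_covers_def using assms by (auto intro: order_trans)
  then show ?thesis
    unfolding hausdorff_premeasure_def by (rule INF_superset_mono) simp
qed

lemma hausdorff_premeasure_tendsto:
  "((\<lambda>\<rho>. hausdorff_premeasure f \<rho> A) \<longlongrightarrow> (SUP \<rho>\<in>{0<..}. hausdorff_premeasure f \<rho> A)) (at_right 0)"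
proof (rule increasing_tendsto)
  show "\<forall>\<^sub>F \<rho> in at_right 0. hausdorff_premeasure f \<rho> A \<le> (SUP \<rho>\<in>{0<..}. hausdorff_premeasure f \<rho> A)"
    by (auto simp: eventually_at_right_less intro!: SUP_upper
        eventually_mono[OF eventually_at_right_less[of 0]])
next
  fix y
  assume "y < (SUP \<rho>\<in>{0<..}. hausdorff_premeasure f \<rho> A)"
  then obtain \<sigma> where \<sigma>: "\<sigma> > 0" "y < hausdorff_premeasure f \<sigma> A"
    by (auto simp: less_SUP_iff)
  then have "y < hausdorff_premeasure f \<rho> A" if "\<rho> < \<sigma>" for \<rho>
    using hausdorff_premeasure_antimono[of \<rho> \<sigma> f A] that by simp
  then show "\<forall>\<^sub>F \<rho> in at_right 0. y < hausdorff_premeasure f \<rho> A"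
    using \<sigma>(1) by (auto simp: eventually_at_right_field)
qed

lemma hausdorff_measure_eq_SUP:
  "hausdorff_measure f A = (SUP \<rho>\<in>{0<..}. hausdorff_premeasure f \<rho> A)"
  unfolding hausdorff_measure_def
  by (intro tendsto_Lim hausdorff_premeasure_tendsto) simp

end

theory Submission imports Defs begin

text \<open>
  In terms of digit sequences, \<open>h\<close> is approximable iff for infinitely many \<open>N\<close> its digits vanish on the block
  from \<open>N\<close> to \<open>r N\<close>, where \<open>\<psi> (3 ^ N) = 3 powi (- r N)\<close>; the balls of radius \<open>3 powi (- n)\<close> are the
  cylinders of level \<open>n\<close>, and \<open>(3 ^ n) powr \<gamma> = 2 ^ n\<close> is their number.  With \<open>F n = f (3 powi (- n))\<close> the
  hypothesis says that \<open>2 ^ n * F n\<close> is monotone, and its limit is an upper bound for the measure of the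
  Cantor set.  Convergence of the series gives measure zero by the obvious covers.

  For divergence assume \<open>2 ^ n * F n\<close> increasing (otherwise replace \<open>F n\<close> by \<open>c / 2 ^ n\<close>, where \<open>c\<close> is
  the limit), and let balls of total cost less than \<open>2 ^ n * F n\<close> be given.  Call a cylinder of level
  \<open>m\<close> cheap if the balls meeting it cost less than \<open>F m\<close> altogether.  Some cylinder is cheap, and every
  cheap cylinder contains a cheap cylinder that ends in a zero block, since otherwise the
  cylinders ending in zero blocks would, by divergence, cost too much.  The intersection of such a nested
  sequence is an approximable point that is not covered.
\<close>

subsection \<open>Binary words\<close>

definition agree :: "nat \<Rightarrow> (nat \<Rightarrow> bool) \<Rightarrow> (nat \<Rightarrow> bool) \<Rightarrow> bool" where
  "agree n x y \<longleftrightarrow> (\<forall>i<n. x i = y i)"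

text \<open>Words are sequences padded with \<open>False\<close>, so that a word doubles as the
  point whose later digits are all zero; this is the role of the fractions
  \<open>g / X^N\<close>.\<close>

definition words :: "nat \<Rightarrow> (nat \<Rightarrow> bool) set" where
  "words n = {w. \<forall>i\<ge>n. \<not> w i}"

lemma agree_sym: "agree n x y \<Longrightarrow> agree n y x"
  by (simp add: agree_def)

lemma agree_trans: "agree n x y \<Longrightarrow> agree n y z \<Longrightarrow> agree n x z"
  by (simp add: agree_def)

lemma agree_mono: "agree n x y \<Longrightarrow> m \<le> n \<Longrightarrow> agree m x y"
  by (simp add: agree_def)

lemma words_eqI: "v \<in> words n \<Longrightarrow> w \<in> words n \<Longrightarrow> agree n v w \<Longrightarrow> v = w"
  by (rule ext) (metis (mono_tags, lifting) agree_def mem_Collect_eq not_less words_def)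

text \<open>A word with its digits on \<open>D\<close> prescribed is determined by the set of other
  positions at which it is \<open>True\<close>.\<close>

lemma bij_betw_words_Pow:
  assumes "D \<subseteq> {..<n}"
  shows "bij_betw (\<lambda>S i. if i \<in> D then c i else i \<in> S) (Pow ({..<n} - D))
           {w \<in> words n. \<forall>i\<in>D. w i = c i}"
proof (rule bij_betw_byWitness[where f' = "\<lambda>w. {i. w i} - D"])
  show "\<forall>S\<in>Pow ({..<n} - D). {i. if i \<in> D then c i else i \<in> S} - D = S"
    by auto
  show "\<forall>w\<in>{w \<in> words n. \<forall>i\<in>D. w i = c i}. (\<lambda>i. if i \<in> D then c i else i \<in> {i. w i} - D) = w"
    by (auto simp: fun_eq_iff)
  show "(\<lambda>S i. if i \<in> D then c i else i \<in> S) ` Pow ({..<n} - D) \<subseteq> {w \<in> words n. \<forall>i\<in>D. w i = c i}"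
    using assms by (auto simp: words_def subset_iff)
  show "(\<lambda>w. {i. w i} - D) ` {w \<in> words n. \<forall>i\<in>D. w i = c i} \<subseteq> Pow ({..<n} - D)"
    by (force simp: words_def not_less[symmetric])
qed

lemma card_words_fixed:
  assumes "D \<subseteq> {..<n}"
  shows "card {w \<in> words n. \<forall>i\<in>D. w i = c i} = 2 ^ (n - card D)"
  using bij_betw_same_card[OF bij_betw_words_Pow[OF assms, of c]] assms
  by (simp add: card_Pow card_Diff_subset finite_subset)

lemma finite_words [simp]: "finite (words n)"
  using bij_betw_finite[OF bij_betw_words_Pow[of "{}" n]] by simp

lemma card_words: "card (words n) = 2 ^ n"
  using card_words_fixed[of "{}" n] by simp

lemma card_words_agree:
  assumes "m \<le> n"
  shows "card {w \<in> words n. agree m w x} = 2 ^ (n - m)"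
  using card_words_fixed[of "{..<m}" n x] assms by (simp add: agree_def Ball_def)

text \<open>The pigeonhole principle behind every contradiction below: disjoint sets that are too
  heavy in total do not fit into \<open>B\<close>.\<close>

lemma (in finite_measure) sum_disjoint_le:
  assumes "finite A" "\<And>a. a \<in> A \<Longrightarrow> S a \<in> sets M" "\<And>a. a \<in> A \<Longrightarrow> S a \<subseteq> B" "B \<in> sets M"
    "disjoint_family_on S A"
  shows "(\<Sum>a\<in>A. measure M (S a)) \<le> measure M B"
proof -
  have "(\<Sum>a\<in>A. measure M (S a)) = measure M (\<Union>a\<in>A. S a)"
    using assms by (intro finite_measure_finite_Union[symmetric]) auto
  also have "\<dots> \<le> measure M B"
    using assms by (intro finite_measure_mono) auto
  finally show ?thesis .
qed

subsection \<open>Weighted covers by cylinders\<close>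

text \<open>The elements of \<open>space M\<close> index the balls of a cover:
  \<open>measure M {i}\<close> is the cost of ball \<open>i\<close>, \<open>lev i\<close> its level
  and \<open>ctr i\<close> a point in it. \<open>F\<close> only bounds costs from below, which
  permits replacing the gauge by a smaller one.\<close>

locale weighted_cover = finite_measure M for M :: "'i measure" +
  fixes F :: "nat \<Rightarrow> real" and lev :: "'i \<Rightarrow> nat" and ctr :: "'i \<Rightarrow> nat \<Rightarrow> bool"
  assumes sets_eq: "sets M = Pow (space M)"
    and weight_le: "\<And>i. i \<in> space M \<Longrightarrow> F (lev i) \<le> measure M {i}"
    and F_pos: "\<And>n. F n > 0"
    and F_antimono: "antimono F"
    and F_scaled_mono: "mono (\<lambda>n. 2 ^ n * F n)"
begin

text \<open>Cylinders are nested or disjoint, so two of them meet exactly when their centres agree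
  on the shorter of the two prefixes.\<close>

definition meets :: "nat \<Rightarrow> (nat \<Rightarrow> bool) \<Rightarrow> 'i set" where
  "meets n x = {i \<in> space M. agree (min n (lev i)) x (ctr i)}"

abbreviation "cost n x \<equiv> measure M (meets n x)"

lemma subset_sets: "S \<subseteq> space M \<Longrightarrow> S \<in> sets M"
  by (simp add: sets_eq)

lemma meets_subset: "meets n x \<subseteq> space M"
  by (auto simp: meets_def)

lemma meets_sets [simp]: "meets n x \<in> sets M"
  by (rule subset_sets[OF meets_subset])

lemma meets_mono:
  assumes "n \<le> p" "agree n w x"
  shows "meets p w \<subseteq> meets n x"
proof
  fix i
  assume "i \<in> meets p w"
  then have "i \<in> space M" "agree (min n (lev i)) w (ctr i)"
    using assms(1) by (auto simp: meets_def elim!: agree_mono)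
  moreover have "agree (min n (lev i)) x w"
    using assms(2) by (auto intro: agree_sym agree_mono)
  ultimately show "i \<in> meets n x"
    using agree_trans by (auto simp: meets_def)
qed

text \<open>As \<open>F\<close> is antitone, a ball of level at most \<open>n\<close> that meets the
  cylinder costs at least \<open>F n\<close> on its own. So no single ball covers a cheap
  cylinder.\<close>

lemma lev_gt_if_cheap:
  assumes "cost n x < F n" "i \<in> meets n x"
  shows "n < lev i"
proof (rule ccontr)
  assume "\<not> n < lev i"
  then have "F n \<le> F (lev i)"
    by (intro antimonoD[OF F_antimono]) simp
  also have "\<dots> \<le> measure M {i}"
    using assms(2) by (intro weight_le) (simp add: meets_def)
  also have "\<dots> \<le> cost n x"
    using assms(2) by (intro finite_measure_mono) auto
  finally show False using assms(1) by simp
qed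

text \<open>A ball of level \<open>l\<close> contains \<open>2 ^ (p - l)\<close> words of length
  \<open>p\<close>, and \<open>2 ^ n * F n \<le> 2 ^ l * F l\<close> bounds this number by a fixed
  multiple of the cost of the ball.\<close>

lemma card_hit_le:
  assumes "J \<subseteq> space M" "\<And>i. i \<in> J \<Longrightarrow> n \<le> lev i"
  shows "card {w \<in> words p. \<exists>i\<in>J. lev i \<le> p \<and> agree (lev i) w (ctr i)}
           \<le> 2 ^ p * measure M J / (2 ^ n * F n)"
proof -
  let ?H = "{w \<in> words p. \<exists>i\<in>J. lev i \<le> p \<and> agree (lev i) w (ctr i)}"
  \<comment> \<open>\<open>J\<close> may be infinite; choosing one ball for each word hit leaves
    finitely many balls.\<close>
  have "\<forall>w\<in>?H. \<exists>i. i \<in> J \<and> lev i \<le> p \<and> agree (lev i) w (ctr i)" by blast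
  then obtain j where j: "\<And>w. w \<in> ?H \<Longrightarrow> j w \<in> J \<and> lev (j w) \<le> p \<and> agree (lev (j w)) w (ctr (j w))"
    by (metis (no_types, lifting))
  have fin: "finite (j ` ?H)" by simp
  have sub: "j ` ?H \<subseteq> J" using j by auto
  have "card ?H \<le> card (\<Union>i\<in>j ` ?H. {w \<in> words p. agree (lev i) w (ctr i)})"
    using j by (intro card_mono finite_UN_I fin) auto
  also have "\<dots> \<le> (\<Sum>i\<in>j ` ?H. card {w \<in> words p. agree (lev i) w (ctr i)})"
    using fin by (rule card_UN_le)
  also have "\<dots> = (\<Sum>i\<in>j ` ?H. 2 ^ (p - lev i))"
    using j by (intro sum.cong refl card_words_agree) auto
  finally have "real (card ?H) \<le> (\<Sum>i\<in>j ` ?H. 2 ^ (p - lev i))"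
    by (metis (mono_tags, lifting) of_nat_le_iff of_nat_sum of_nat_numeral of_nat_power sum.cong)
  also have "\<dots> \<le> (\<Sum>i\<in>j ` ?H. 2 ^ p * measure M {i} / (2 ^ n * F n))"
  proof (rule sum_mono)
    fix i assume i: "i \<in> j ` ?H"
    then have le: "lev i \<le> p" and iJ: "i \<in> J" using j by blast+
    have "(2::real) ^ (p - lev i) * (2 ^ n * F n) \<le> 2 ^ (p - lev i) * (2 ^ lev i * F (lev i))"
      using monoD[OF F_scaled_mono assms(2)[OF iJ]] by (intro mult_left_mono) auto
    also have "\<dots> = 2 ^ p * F (lev i)"
      using le by (simp add: mult.assoc[symmetric] power_add[symmetric])
    also have "\<dots> \<le> 2 ^ p * measure M {i}"
      using iJ assms(1) by (intro mult_left_mono weight_le) auto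
    finally show "2 ^ (p - lev i) \<le> 2 ^ p * measure M {i} / (2 ^ n * F n)"
      using F_pos[of n] by (simp add: field_simps)
  qed
  also have "\<dots> = 2 ^ p * (\<Sum>i\<in>j ` ?H. measure M {i}) / (2 ^ n * F n)"
    by (simp add: sum_distrib_left sum_divide_distrib)
  also have "\<dots> \<le> 2 ^ p * measure M J / (2 ^ n * F n)"
  proof -
    have "(\<Sum>i\<in>j ` ?H. measure M {i}) \<le> measure M J"
      using sub assms(1) by (intro sum_disjoint_le fin subset_sets) (auto simp: disjoint_family_on_def)
    then show ?thesis using F_pos[of n] by (intro divide_right_mono mult_left_mono) auto
  qed
  finally show ?thesis .
qed

text \<open>A ball of level at least \<open>p\<close> fixes the first \<open>p\<close> digits, hence
  meets only one cylinder of level \<open>p\<close>.\<close>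

lemma disjoint_meets_of_deep:
  assumes "\<And>i w. w \<in> W \<Longrightarrow> i \<in> meets p w \<Longrightarrow> p \<le> lev i" "W \<subseteq> words p"
  shows "disjoint_family_on (meets p) W"
proof -
  have "v = w" if "v \<in> W" "w \<in> W" "i \<in> meets p v" "i \<in> meets p w" for v w i
  proof (rule words_eqI)
    have "p \<le> lev i" using assms(1) that by blast
    then show "agree p v w" using that by (auto simp: meets_def min_def agree_def split: if_splits)
  qed (use that assms in auto)
  then show ?thesis by (auto simp: disjoint_family_on_def)
qed

text \<open>Otherwise the \<open>2 ^ n\<close> cylinders of level \<open>n\<close>, which share no
  ball, would cost at least \<open>2 ^ n * F n\<close> together.\<close>

lemma ex_cheap_word:
  assumes "\<And>i. i \<in> space M \<Longrightarrow> n \<le> lev i" "measure M (space M) < 2 ^ n * F n"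
  shows "\<exists>x\<in>words n. cost n x < F n"
proof (rule ccontr)
  assume "\<not> ?thesis"
  then have "(\<Sum>x\<in>words n. F n) \<le> (\<Sum>x\<in>words n. cost n x)"
    by (intro sum_mono) force
  also have "\<dots> \<le> measure M (space M)"
    using assms(1)
    by (intro sum_disjoint_le disjoint_meets_of_deep finite_words meets_sets meets_subset)
      (use meets_subset in blast)+
  finally show False using assms(2) by (simp add: card_words)
qed

text \<open>Every single level is finite, so these sets decrease to the empty set, and a finite
  measure is continuous from above.\<close>

lemma tail_tendsto_0: "(\<lambda>p. measure M {i \<in> space M. p < lev i}) \<longlonglongrightarrow> 0"
proof -
  have "(\<lambda>p. measure M {i \<in> space M. p < lev i}) \<longlonglongrightarrow> measure M (\<Inter>p. {i \<in> space M. p < lev i})"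
    by (intro finite_Lim_measure_decseq) (auto simp: sets_eq decseq_def)
  also have "(\<Inter>p. {i \<in> space M. p < lev i}) = {}" by auto
  finally show ?thesis by simp
qed

text \<open>A cheap cylinder is only partly covered, and the balls smaller than level \<open>p\<close> weigh little in total;
  so an average uncovered cylinder of level \<open>p\<close> is very cheap.\<close>

lemma ex_very_cheap_extension:
  assumes cheap: "cost n x < F n" and "e > 0"
  shows "\<exists>p\<ge>n. \<exists>w\<in>words p. agree n w x \<and> cost p w \<le> e * F p"
proof -
  \<comment> \<open>At least \<open>2 ^ (p - n) * (1 - cost n x / F n)\<close> words will stay
    uncovered. If each cost more than \<open>e * F p\<close>, their total would be at least
    \<open>d\<close>, because \<open>F n \<le> 2 ^ (p - n) * F p\<close>.\<close>
  define d where "d = e * (F n - cost n x)"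
  have "d > 0" using assms by (simp add: d_def)
  then have "\<forall>\<^sub>F p in sequentially. measure M {i \<in> space M. p < lev i} < d"
    by (rule order_tendstoD(2)[OF tail_tendsto_0])
  then have "\<forall>\<^sub>F p in sequentially. n \<le> p \<and> measure M {i \<in> space M. p < lev i} < d"
    by (intro eventually_conj eventually_ge_at_top)
  then obtain p where np: "n \<le> p" and tail: "measure M {i \<in> space M. p < lev i} < d"
    using eventually_happens'[OF sequentially_bot] by blast
  \<comment> \<open>\<open>H\<close> contains the words lying inside a ball of level at most
    \<open>p\<close>. The words left over meet only balls of level above \<open>p\<close>, whose
    total cost is below \<open>d\<close>.\<close>
  define H where "H = {w \<in> words p. \<exists>i\<in>meets n x. lev i \<le> p \<and> agree (lev i) w (ctr i)}"
  define Q where "Q = {w \<in> words p. agree n w x} - H"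
  have Q: "Q \<subseteq> words p" "finite Q" unfolding Q_def by auto
  have deep: "p < lev i" if "w \<in> Q" "i \<in> meets p w" for w i
  proof (rule ccontr)
    assume "\<not> (p < lev i)"
    moreover have "i \<in> meets n x" using meets_mono[OF np] that by (auto simp: Q_def)
    ultimately show False using that by (auto simp: Q_def H_def meets_def min_def split: if_splits)
  qed
  have "real (card H) \<le> 2 ^ p * cost n x / (2 ^ n * F n)"
    unfolding H_def using less_imp_le[OF lev_gt_if_cheap[OF cheap]] by (intro card_hit_le meets_subset)
  also have "\<dots> = 2 ^ (p - n) * (cost n x / F n)"
    using np by (simp add: power_diff field_simps)
  finally have "2 ^ (p - n) * (1 - cost n x / F n) \<le> 2 ^ (p - n) - real (card H)"
    by (simp add: algebra_simps)
  also have "\<dots> \<le> real (card {w \<in> words p. agree n w x}) - real (card H)"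
    using np by (simp add: card_words_agree)
  also have "\<dots> \<le> real (card Q)"
    using diff_card_le_card_Diff[of H "{w \<in> words p. agree n w x}"] by (simp add: Q_def H_def)
  finally have cQ: "2 ^ (p - n) * (1 - cost n x / F n) \<le> real (card Q)" .
  have scaled: "2 ^ n * F n \<le> 2 ^ p * F p" using monoD[OF F_scaled_mono np] .
  have "\<exists>w\<in>Q. cost p w \<le> e * F p"
  proof (rule ccontr)
    assume "\<not> ?thesis"
    then have "(\<Sum>w\<in>Q. e * F p) \<le> (\<Sum>w\<in>Q. cost p w)"
      by (intro sum_mono) force
    also have "\<dots> \<le> measure M {i \<in> space M. p < lev i}"
    proof (rule sum_disjoint_le[OF Q(2) meets_sets])
      show "meets p w \<subseteq> {i \<in> space M. p < lev i}" if "w \<in> Q" for w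
        using deep[OF that] meets_subset by blast
      show "disjoint_family_on (meets p) Q"
        using deep Q(1) by (intro disjoint_meets_of_deep) (auto intro: less_imp_le)
    qed (simp add: sets_eq)
    also have "\<dots> < d" by fact
    finally have "real (card Q) * (e * F p) < e * (F n - cost n x)" by (simp add: d_def)
    moreover have "2 ^ (p - n) * (1 - cost n x / F n) * (e * F p) \<le> real (card Q) * (e * F p)"
      using cQ \<open>e > 0\<close> F_pos[of p] by (intro mult_right_mono) auto
    ultimately have "2 ^ (p - n) * (1 - cost n x / F n) * (e * F p) < e * (F n - cost n x)" by simp
    also have "\<dots> = (e * (1 - cost n x / F n)) * F n"
      using F_pos[of n] by (simp add: field_simps)
    also have "\<dots> \<le> (e * (1 - cost n x / F n)) * (2 ^ (p - n) * F p)"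
      using scaled np \<open>e > 0\<close> cheap F_pos[of n]
      by (intro mult_left_mono) (auto simp: power_diff field_simps)
    finally show False by (simp add: mult_ac)
  qed
  then show ?thesis using np by (auto simp: Q_def)
qed

end

text \<open>Partial sums of a divergent nonnegative series are unbounded; taking the first
  \<open>Q\<close> at which they reach \<open>C\<close> also keeps all earlier ones small.\<close>

lemma ex_first_partial_sum_ge:
  fixes b :: "nat \<Rightarrow> real"
  assumes "\<And>n. 0 \<le> b n" "\<not> summable b"
  shows "\<exists>Q. C \<le> sum b {k..<Q} \<and> (\<forall>n<Q. sum b {k..<n} < C)"
proof -
  have "\<exists>Q. C \<le> sum b {k..<Q}"
  proof (rule ccontr)
    assume "\<not> ?thesis"
    then have "sum b {k..<k + n} \<le> C" for n
      by (meson linear)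
    moreover have "(\<Sum>i<n. b (i + k)) = sum b {k..<k + n}" for n
      using sum.shift_bounds_nat_ivl[of b 0 k n] by (simp add: add.commute[of n k] atLeast0LessThan)
    ultimately have "(\<Sum>i<n. b (i + k)) \<le> C" for n
      by simp
    then have "summable (\<lambda>i. b (i + k))"
      using assms(1) by (intro summableI_nonneg_bounded)
    then show False using assms(2) by simp
  qed
  then have "C \<le> sum b {k..<LEAST Q. C \<le> sum b {k..<Q}}"
    by (rule LeastI_ex)
  moreover have "\<forall>n<LEAST Q. C \<le> sum b {k..<Q}. sum b {k..<n} < C"
    using not_less_Least not_le by blast
  ultimately show ?thesis by blast
qed

lemma card_words_agree_last:
  assumes "p < n"
  shows "real (card {w \<in> words n. agree p w y \<and> w (n - 1)}) = 2 ^ (n - p) / 2"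
proof -
  have "{w \<in> words n. agree p w y \<and> w (n - 1)}
      = {w \<in> words n. \<forall>i\<in>insert (n - 1) {..<p}. w i = (if i < p then y i else True)}"
    using assms by (auto simp: agree_def)
  also have "card \<dots> = 2 ^ (n - card (insert (n - 1) {..<p}))"
    using assms by (intro card_words_fixed) auto
  also have "card (insert (n - 1) {..<p}) = Suc p"
    using assms by (subst card_insert_disjoint) auto
  finally show ?thesis
    using assms by (simp add: Suc_diff_Suc[symmetric])
qed

text \<open>Each of the \<open>q - m\<close> zeros halves the count. The factor is written as
  \<open>2 ^ m / 2 ^ q\<close> to match the series of block densities that is estimated
  later.\<close>

lemma card_words_agree_gap:
  assumes "p \<le> m" "m \<le> q" "q \<le> n"
  shows "real (card {w \<in> words n. agree p w y \<and> (\<forall>i\<in>{m..<q}. \<not> w i)})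
           = 2 ^ (n - p) * (2 ^ m / 2 ^ q)"
proof -
  have "{w \<in> words n. agree p w y \<and> (\<forall>i\<in>{m..<q}. \<not> w i)}
      = {w \<in> words n. \<forall>i\<in>{..<p} \<union> {m..<q}. w i = (if i < p then y i else False)}"
    using assms(1) by (intro Collect_cong conj_cong refl) (force simp: agree_def)
  also have "card \<dots> = 2 ^ (n - card ({..<p} \<union> {m..<q}))"
    using assms by (intro card_words_fixed) auto
  also have "card ({..<p} \<union> {m..<q}) = p + (q - m)"
    using assms(1) by (subst card_Un_disjoint) auto
  also have "real (2 ^ (n - (p + (q - m)))) = 2 ^ (n - p) * (2 ^ m / 2 ^ q)"
  proof -
    have "n - p = n - (p + (q - m)) + (q - m)" using assms by simp
    then have "(2::real) ^ (n - p) = 2 ^ (n - (p + (q - m))) * 2 ^ (q - m)"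
      by (metis power_add)
    moreover have "(2::real) ^ q = 2 ^ (q - m) * 2 ^ m"
      using assms(2) by (metis le_add_diff_inverse2 power_add)
    ultimately show ?thesis by simp
  qed
  finally show ?thesis .
qed

section \<open>Construction of an uncovered approximable point\<close>

context weighted_cover
begin

text \<open>The cylinders \<open>(r N, w)\<close> with \<open>w \<in> A N\<close> are chosen so that no ball of the cover meets two of them:
  \<open>w\<close> ends in a nonzero digit and avoids the zero blocks belonging to smaller \<open>N\<close>.  They carry too much
  weight for all of them to be expensive.\<close>

lemma ex_cheap_extension_with_zero_block:
  assumes r: "\<And>N. N \<ge> N0 \<Longrightarrow> N < r N" and diverges: "\<not> summable (\<lambda>N. 2 ^ N * F (r N))"
    and "cost n x < F n"
  shows "\<exists>N\<ge>K. n \<le> N \<and> N < r N \<and> (\<exists>w\<in>words N. agree n w x \<and> cost (r N) w < F (r N))"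
proof -
  \<comment> \<open>The value \<open>1/64\<close> has to be below \<open>1/32\<close>: the sets
    \<open>A N\<close> will contain at least a quarter of the words below \<open>y\<close>, and a
    quarter of \<open>2 ^ p * F p / 8\<close>, divided by \<open>2 ^ p\<close>, is
    \<open>F p / 32\<close>.\<close>
  obtain p y where p: "n \<le> p" "agree n y x" and cost: "cost p y \<le> 1/64 * F p"
    using ex_very_cheap_extension[OF assms(3), of "1/64"] by auto
  have cheap: "cost p y < F p" using cost F_pos[of p] by simp
  define k where "k = Suc p + K + N0"
  \<comment> \<open>Up to \<open>Q\<close> there is enough weight for a contradiction; before
    \<open>Q\<close> the weight stays below the threshold, which makes zero blocks rare.\<close>
  obtain Q where Q: "2 ^ p * F p / 8 \<le> (\<Sum>N\<in>{k..<Q}. 2 ^ N * F (r N))"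
    and Q_least: "\<And>N. N < Q \<Longrightarrow> (\<Sum>M\<in>{k..<N}. 2 ^ M * F (r M)) < 2 ^ p * F p / 8"
    using ex_first_partial_sum_ge[OF _ diverges, of "2 ^ p * F p / 8" k] F_pos
    by (auto simp: less_imp_le)
  have k: "p < N" "K \<le> N" "N < r N" if "N \<ge> k" for N
    using that r[of N] by (auto simp: k_def)
  define L where "L N = {w \<in> words N. agree p w y \<and> w (N - 1)}" for N
  define Z where "Z N M = {w \<in> words N. agree p w y \<and> (\<forall>i\<in>{M..<r M}. \<not> w i)}" for N M
  define H where "H N = {w \<in> words N. \<exists>i\<in>meets p y. lev i \<le> N \<and> agree (lev i) w (ctr i)}" for N
  \<comment> \<open>Blocks with \<open>N \<le> r M\<close> need no exclusion: they contain position
    \<open>N - 1\<close>, where the words of \<open>L N\<close> have a nonzero digit.\<close>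
  define B where "B N = H N \<union> (\<Union>M\<in>{M\<in>{k..<N}. r M < N}. Z N M)" for N
  define A where "A N = L N - B N" for N

  \<comment> \<open>By \<open>2 ^ p * F p \<le> 2 ^ r M * F (r M)\<close>, the density
    \<open>2 ^ M / 2 ^ r M\<close> of words with the zero block of \<open>M\<close> is at most the
    weight of stage \<open>M\<close> divided by \<open>2 ^ p * F p\<close>.\<close>
  have gaps: "(\<Sum>M\<in>{k..<N}. 2 ^ M / 2 ^ r M) \<le> (1/8 :: real)" if "N < Q" for N
  proof -
    have "2 ^ p * F p * (2 ^ M / 2 ^ r M) \<le> 2 ^ M * F (r M)" if "M \<ge> k" for M
    proof -
      have "p \<le> r M" using k[OF that] by simp
      then have "2 ^ p * F p * (2 ^ M / 2 ^ r M) \<le> 2 ^ r M * F (r M) * (2 ^ M / 2 ^ r M)"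
        using monoD[OF F_scaled_mono, of p "r M"] by (intro mult_right_mono) auto
      then show ?thesis by (simp add: field_simps)
    qed
    then have "2 ^ p * F p * (\<Sum>M\<in>{k..<N}. 2 ^ M / 2 ^ r M) \<le> (\<Sum>M\<in>{k..<N}. 2 ^ M * F (r M))"
      unfolding sum_distrib_left by (intro sum_mono) simp
    also have "\<dots> < 2 ^ p * F p * (1/8)" using Q_least[OF that] by simp
    finally show ?thesis using F_pos[of p] by simp
  qed

  \<comment> \<open>Half of the words below \<open>y\<close> end in a nonzero digit; a proportion of
    at most 1/64 lies in balls and at most 1/8 has an earlier zero block. More than a quarter
    remains.\<close>
  have card_A: "2 ^ (N - p) / 4 \<le> real (card (A N))" if N: "N \<in> {k..<Q}" for N
  proof -
    have "card (B N) \<le> card (H N) + (\<Sum>M\<in>{M\<in>{k..<N}. r M < N}. card (Z N M))"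
      unfolding B_def by (intro order_trans[OF card_Un_le] add_left_mono card_UN_le) simp
    then have "real (card (B N)) \<le> card (H N) + (\<Sum>M\<in>{M\<in>{k..<N}. r M < N}. real (card (Z N M)))"
      by (metis of_nat_add of_nat_le_iff of_nat_sum)
    also have "(\<Sum>M\<in>{M\<in>{k..<N}. r M < N}. real (card (Z N M)))
        = (\<Sum>M\<in>{M\<in>{k..<N}. r M < N}. 2 ^ (N - p) * (2 ^ M / 2 ^ r M))"
      unfolding Z_def using k by (intro sum.cong refl card_words_agree_gap) (auto intro: less_imp_le)
    also have "\<dots> \<le> (\<Sum>M\<in>{k..<N}. 2 ^ (N - p) * (2 ^ M / 2 ^ r M))"
      by (intro sum_mono2) auto
    also have "\<dots> \<le> 2 ^ (N - p) * (1/8)"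
      unfolding sum_distrib_left[symmetric] using N by (intro mult_left_mono gaps) auto
    also have "real (card (H N)) \<le> 2 ^ N * cost p y / (2 ^ p * F p)"
      unfolding H_def using less_imp_le[OF lev_gt_if_cheap[OF cheap]] by (intro card_hit_le meets_subset)
    also have "\<dots> \<le> 2 ^ N * (1/64 * F p) / (2 ^ p * F p)"
      using cost F_pos[of p] by (intro divide_right_mono mult_left_mono) auto
    also have "\<dots> = 2 ^ (N - p) * (1/64)"
      using F_pos[of p] k(1)[of N] N by (simp add: power_diff)
    finally have "real (card (B N)) \<le> 2 ^ (N - p) * (1/64) + 2 ^ (N - p) * (1/8)" by simp
    moreover have "real (card (L N)) = 2 ^ (N - p) / 2"
      unfolding L_def using N k(1) by (intro card_words_agree_last) auto
    moreover have "finite (B N)" by (auto simp: B_def H_def Z_def)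
    then have "card (L N) - card (B N) \<le> card (A N)"
      unfolding A_def by (rule diff_card_le_card_Diff)
    then have "real (card (L N)) - real (card (B N)) \<le> real (card (A N))" by linarith
    moreover have "(0::real) < 2 ^ (N - p)" by simp
    ultimately show ?thesis by linarith
  qed

  have A_sub: "meets (r N) w \<subseteq> meets p y" if "N \<in> {k..<Q}" "w \<in> A N" for N w
    using that k[of N] by (intro meets_mono) (auto simp: A_def L_def)
  \<comment> \<open>A ball of level at most \<open>N < r N\<close> that meets the cylinder of
    \<open>w\<close> contains it, which would put \<open>w\<close> into \<open>H N\<close>.\<close>
  have deep: "N < lev i" if "N \<in> {k..<Q}" "w \<in> A N" "i \<in> meets (r N) w" for N w i
  proof (rule ccontr)
    assume "\<not> N < lev i"
    moreover have "w \<in> words N" "w \<notin> H N" using that by (auto simp: A_def L_def B_def)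
    moreover have "i \<in> meets p y" using A_sub that by blast
    moreover have "agree (min (r N) (lev i)) w (ctr i)" using that by (simp add: meets_def)
    ultimately show False using k[of N] that(1) by (auto simp: H_def min_def split: if_splits)
  qed
  \<comment> \<open>Suppose \<open>N' < N\<close>. The common ball forces \<open>w\<close> to agree
    with \<open>w'\<close>, which is zero from \<open>N'\<close> on. So \<open>w\<close> has the
    whole zero block of \<open>N'\<close> or, if that block reaches position \<open>N - 1\<close>, a
    zero last digit; both are excluded.\<close>
  have le: "N \<le> N'" if "N \<in> {k..<Q}" "w \<in> A N" "i \<in> meets (r N) w"
    "N' \<in> {k..<Q}" "w' \<in> A N'" "i \<in> meets (r N') w'" for N w N' w' i
  proof (rule ccontr)
    assume "\<not> N \<le> N'"
    have ww': "w j = w' j" if "j \<le> N" "j < r N'" for j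
      using \<open>i \<in> meets (r N) w\<close> \<open>i \<in> meets (r N') w'\<close> that k(3)[of N] \<open>N \<in> _\<close>
        deep[OF \<open>N \<in> _\<close> \<open>w \<in> A N\<close> \<open>i \<in> meets (r N) w\<close>]
      by (auto simp: meets_def agree_def)
    have zero: "\<not> w j" if "j \<le> N" "j < r N'" "N' \<le> j" for j
      using ww'[OF that(1,2)] that(3) \<open>w' \<in> A N'\<close> by (auto simp: A_def L_def words_def)
    show False
    proof (cases "r N' < N")
      case True
      then have "w \<in> Z N N'" "N' \<in> {k..<N}"
        using zero \<open>\<not> N \<le> N'\<close> \<open>w \<in> A N\<close> \<open>N' \<in> _\<close> by (auto simp: Z_def A_def L_def)
      then show False using True \<open>w \<in> A N\<close> by (auto simp: A_def B_def)
    next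
      case False
      then show False
        using zero[of "N - 1"] \<open>\<not> N \<le> N'\<close> \<open>w \<in> A N\<close> by (auto simp: A_def L_def)
    qed
  qed
  have disj: "disjoint_family_on (\<lambda>(N, w). meets (r N) w) (Sigma {k..<Q} A)"
  proof -
    have "N = N' \<and> w = w'" if *: "N \<in> {k..<Q}" "w \<in> A N" "i \<in> meets (r N) w"
      "N' \<in> {k..<Q}" "w' \<in> A N'" "i \<in> meets (r N') w'" for N w N' w' i
    proof
      show "N = N'" using le[OF *] le[OF *(4-6) *(1-3)] by simp
      then show "w = w'"
        using * deep[OF *(1-3)] k(3)[of N]
        by (intro words_eqI[of w N w']) (auto simp: A_def L_def meets_def agree_def)
    qed
    then show ?thesis unfolding disjoint_family_on_def by blast
  qed
  have "\<exists>N\<in>{k..<Q}. \<exists>w\<in>A N. cost (r N) w < F (r N)"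
  proof (rule ccontr)
    assume exp: "\<not> ?thesis"
    have "F p / 32 = (2 ^ p * F p / 8) / (4 * 2 ^ p)" by simp
    also have "\<dots> \<le> (\<Sum>N\<in>{k..<Q}. 2 ^ N * F (r N)) / (4 * 2 ^ p)"
      using Q by (rule divide_right_mono) simp
    also have "\<dots> = (\<Sum>N\<in>{k..<Q}. 2 ^ (N - p) / 4 * F (r N))"
      unfolding sum_divide_distrib
    proof (intro sum.cong refl)
      fix N assume "N \<in> {k..<Q}"
      then show "2 ^ N * F (r N) / (4 * 2 ^ p) = 2 ^ (N - p) / 4 * F (r N)"
        using k(1)[of N] by (simp add: power_diff)
    qed
    also have "\<dots> \<le> (\<Sum>N\<in>{k..<Q}. real (card (A N)) * F (r N))"
      using card_A F_pos by (intro sum_mono mult_right_mono) (auto intro: less_imp_le)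
    also have "\<dots> = (\<Sum>N\<in>{k..<Q}. \<Sum>w\<in>A N. F (r N))" by simp
    also have "\<dots> \<le> (\<Sum>N\<in>{k..<Q}. \<Sum>w\<in>A N. cost (r N) w)"
      using exp by (intro sum_mono) (meson not_le)
    also have "\<dots> = (\<Sum>(N, w)\<in>Sigma {k..<Q} A. cost (r N) w)"
      by (rule sum.Sigma) (auto simp: A_def L_def)
    also have "\<dots> = (\<Sum>a\<in>Sigma {k..<Q} A. measure M (case a of (N, w) \<Rightarrow> meets (r N) w))"
      by (intro sum.cong) auto
    also have "\<dots> \<le> cost p y"
    proof (rule sum_disjoint_le[OF _ _ _ meets_sets disj])
      show "finite (Sigma {k..<Q} A)" by (auto simp: A_def L_def)
      show "(case a of (N, w) \<Rightarrow> meets (r N) w) \<subseteq> meets p y" if "a \<in> Sigma {k..<Q} A" for a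
        using that A_sub by (cases a) blast
    qed auto
    finally show False using cost F_pos[of p] by simp
  qed
  then obtain N w where "N \<in> {k..<Q}" "w \<in> A N" "cost (r N) w < F (r N)" by blast
  moreover from this have "agree n w x"
    using p by (auto simp: A_def L_def intro: agree_trans agree_mono)
  ultimately show ?thesis
    using k[of N] p(1) by (intro exI[of _ N] conjI bexI[of _ w]) (auto simp: A_def L_def)
qed

text \<open>A ball \<open>i\<close> around the limit point would meet the cheap cylinder chosen at
  stage \<open>lev i\<close>. That cylinder has level at least \<open>lev i\<close>, against
  \<open>lev_gt_if_cheap\<close>.\<close>

lemma ex_uncovered_point:
  assumes r: "\<And>N. N \<ge> N0 \<Longrightarrow> N < r N" and diverges: "\<not> summable (\<lambda>N. 2 ^ N * F (r N))"
    and small: "\<And>i. i \<in> space M \<Longrightarrow> n \<le> lev i" "measure M (space M) < 2 ^ n * F n"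
  shows "\<exists>h. (\<forall>K. \<exists>N\<ge>K. \<forall>i\<in>{N..<r N}. \<not> h i) \<and> (\<forall>i\<in>space M. \<not> agree (lev i) h (ctr i))"
proof -
  \<comment> \<open>The clause \<open>k \<le> m\<close> drives the levels to infinity. In
    \<open>R\<close>, the new word lies in \<open>words N\<close> but is taken at level
    \<open>r N\<close>, so it ends in the zero block of \<open>N\<close>.\<close>
  define P where "P k s = (case s of (m, x) \<Rightarrow> k \<le> m \<and> cost m x < F m)" for k :: nat and s
  define R where "R k s t = (case s of (m, x) \<Rightarrow> case t of (m', x') \<Rightarrow>
      m \<le> m' \<and> agree m x' x \<and> (\<exists>N\<ge>k. m' = r N \<and> x' \<in> words N))" for k :: nat and s t
  obtain x0 where "cost n x0 < F n" using ex_cheap_word[OF small] by blast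
  then have "P 0 (n, x0)" by (simp add: P_def)
  moreover have "\<exists>t. P (Suc k) t \<and> R k s t" if Ps: "P k s" for k s
  proof -
    obtain m x where s: "s = (m, x)" by force
    then have "cost m x < F m" "k \<le> m" using Ps by (auto simp: P_def)
    then obtain N w where "k \<le> N" "m \<le> N" "N < r N" "w \<in> words N" "agree m w x" "cost (r N) w < F (r N)"
      using ex_cheap_extension_with_zero_block[OF r diverges, where n = m and x = x and K = k] by blast
    then show ?thesis unfolding s by (intro exI[of _ "(r N, w)"]) (auto simp: P_def R_def)
  qed
  ultimately obtain s where s: "\<And>k. P k (s k)" "\<And>k. R k (s k) (s (Suc k))"
    using dependent_nat_choice[of P R] by metis
  define m where "m k = fst (s k)" for k
  define x where "x k = snd (s k)" for k
  have P: "k \<le> m k" "cost (m k) (x k) < F (m k)" for k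
    using s(1)[of k] by (auto simp: P_def m_def x_def split: prod.splits)
  have R: "m k \<le> m (Suc k)" "agree (m k) (x (Suc k)) (x k)"
    "\<exists>N\<ge>k. m (Suc k) = r N \<and> x (Suc k) \<in> words N" for k
    using s(2)[of k] by (auto simp: R_def m_def x_def split: prod.splits)
  have ext: "m k \<le> m j \<and> agree (m k) (x j) (x k)" if "k \<le> j" for k j
    using that
  proof (induction j rule: dec_induct)
    case base
    then show ?case by (simp add: agree_def)
  next
    case (step j)
    then show ?case
      using R(1,2)[of j] by (auto intro: agree_trans agree_mono)
  qed
  \<comment> \<open>Digit \<open>i\<close> is settled at stage \<open>Suc i\<close>, whose level
    exceeds \<open>i\<close>.\<close>
  define h where "h i = x (Suc i) i" for i
  have h: "agree (m k) h (x k)" for k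
    unfolding agree_def
  proof (intro allI impI)
    fix i assume "i < m k"
    moreover have "i < m (Suc i)" using P(1)[of "Suc i"] by simp
    ultimately show "h i = x k i"
      using ext[of k "Suc i"] ext[of "Suc i" k] by (cases "k \<le> Suc i") (auto simp: h_def agree_def)
  qed
  show ?thesis
  proof (intro exI[of _ h] conjI allI ballI)
    fix K
    obtain N where "N \<ge> K" "m (Suc K) = r N" "x (Suc K) \<in> words N" using R(3) by blast
    then show "\<exists>N\<ge>K. \<forall>i\<in>{N..<r N}. \<not> h i"
      using h[of "Suc K"] by (auto simp: agree_def words_def)
  next
    fix i assume i: "i \<in> space M"
    show "\<not> agree (lev i) h (ctr i)"
    proof
      assume "agree (lev i) h (ctr i)"
      then have "agree (min (m (lev i)) (lev i)) (x (lev i)) (ctr i)"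
        by (rule agree_trans[OF agree_mono[OF agree_sym[OF h] min.cobounded1] agree_mono[OF _ min.cobounded2]])
      then have "i \<in> meets (m (lev i)) (x (lev i))" using i by (simp add: meets_def)
      then have "m (lev i) < lev i" by (rule lev_gt_if_cheap[OF P(2)])
      then show False using P(1)[of "lev i"] by simp
    qed
  qed
qed

end

subsection \<open>Laurent series as digit sequences\<close>

lemma three_powi_less_iff: "(3::real) powi m < 3 powi n \<longleftrightarrow> m < n"
proof
  assume "(3::real) powi m < 3 powi n"
  then show "m < n"
    using power_int_increasing[of n m "3::real"] by (auto simp: not_less[symmetric])
qed (simp add: power_int_strict_increasing)

lemma three_powi_le_iff: "(3::real) powi m \<le> 3 powi n \<longleftrightarrow> m \<le> n"
  using three_powi_less_iff[of n m] by (simp add: not_less[symmetric])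

lemma ex_three_powi_less:
  assumes "0 < (\<rho>::real)"
  shows "\<exists>n. 3 powi - int n < \<rho>"
proof -
  obtain n where "(1/3) ^ n < \<rho>" using real_arch_pow_inv[OF assms, of "1/3"] by auto
  then show ?thesis by (intro exI[of _ n]) (simp add: power_int_minus power_one_over inverse_eq_divide)
qed

text \<open>The strict inequality makes the coefficient at \<open>- k\<close> itself vanish; hence a
  ball of radius \<open>3 powi - n\<close> fixes exactly \<open>n\<close> Cantor digits.\<close>

lemma laurent_abs_less_iff:
  "laurent_abs h < 3 powi k \<longleftrightarrow> (\<forall>n\<le>- k. fls_nth h n = 0)"
proof (cases "h = 0")
  case False
  have "laurent_abs h < 3 powi k \<longleftrightarrow> - k + 1 \<le> fls_subdegree h"
    using False by (auto simp: laurent_abs_def three_powi_less_iff)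
  also have "\<dots> \<longleftrightarrow> (\<forall>n\<le>- k. fls_nth h n = 0)"
    using fls_subdegree_geI[OF False, of "- k + 1"] by (auto intro: fls_eq0_below_subdegree)
  finally show ?thesis .
qed (simp add: laurent_abs_def)

lemma mem_laurent_ball_iff:
  "y \<in> laurent_ball x k \<longleftrightarrow> (\<forall>n\<le>- k. fls_nth y n = fls_nth x n)"
  by (simp add: laurent_ball_def laurent_abs_less_iff)

text \<open>Needed to tell the digits 0 and 2 apart. If \<open>2 = 0\<close>, then
  \<open>x + 1\<close> for the third element \<open>x\<close> could be none of \<open>0\<close>,
  \<open>1\<close>, \<open>x\<close>.\<close>

lemma two_neq_zero_of_card_eq_3:
  assumes "CARD('a::field) = 3"
  shows "(2::'a) \<noteq> 0"
proof
  assume "(2::'a) = 0"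
  then have 11: "(1::'a) + 1 = 0" by simp
  have fin: "finite (UNIV :: 'a set)" using assms by (intro card_ge_0_finite) simp
  have "UNIV \<noteq> {0, 1 :: 'a}"
  proof
    assume "UNIV = {0, 1 :: 'a}"
    then have "CARD('a) = card {0, 1 :: 'a}" by (rule arg_cong)
    then show False using assms by simp
  qed
  then obtain x :: 'a where x: "x \<noteq> 0" "x \<noteq> 1" by blast
  then have "card {0, 1, x} = CARD('a)" using assms by simp
  then have "{0, 1, x} = UNIV" using fin by (intro card_subset_eq) auto
  then have "x + 1 \<in> {0, 1, x}" by simp
  moreover have "x + 1 \<noteq> 0"
  proof
    assume "x + 1 = 0"
    then have "x + 1 = 1 + 1" using 11 by simp
    then show False using x by simp
  qed
  ultimately show False using x by auto
qed

text \<open>Digit \<open>i\<close> of a sequence is the coefficient of \<open>X powi (- (i + 1))\<close>.\<close>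

definition cantor_point :: "(nat \<Rightarrow> bool) \<Rightarrow> 'a::field fls" where
  "cantor_point x = fps_to_fls (Abs_fps (\<lambda>n. if n \<ge> 1 \<and> x (n - 1) then 2 else 0))"

lemma fls_nth_cantor_point:
  "fls_nth (cantor_point x) n = (if n \<ge> 1 \<and> x (nat n - 1) then 2 else 0)"
  by (auto simp: cantor_point_def)

lemma cantor_set_eq: "cantor_set = range (cantor_point :: _ \<Rightarrow> 'a::field fls)"
proof (intro set_eqI iffI)
  fix h :: "'a fls"
  assume "h \<in> cantor_set"
  then have h: "\<And>n. n \<le> 0 \<Longrightarrow> fls_nth h n = 0" "\<And>n. n \<ge> 1 \<Longrightarrow> fls_nth h n \<in> {0, 2}"
    using laurent_abs_less_iff[of h 0] by (auto simp: cantor_set_def)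
  have "h = cantor_point (\<lambda>i. fls_nth h (int i + 1) = 2)"
  proof (rule fls_eqI)
    fix n
    have "int (nat n - 1) + 1 = n" if "n \<ge> 1" using that by simp
    then show "fls_nth h n = fls_nth (cantor_point (\<lambda>i. fls_nth h (int i + 1) = 2)) n"
      using h(1)[of n] h(2)[of n] by (cases "n \<ge> 1") (auto simp: fls_nth_cantor_point)
  qed
  then show "h \<in> range cantor_point" by blast
next
  fix h :: "'a fls"
  assume "h \<in> range cantor_point"
  then show "h \<in> cantor_set"
    using laurent_abs_less_iff[of h 0] by (auto simp: cantor_set_def fls_nth_cantor_point)
qed

text \<open>For \<open>k \<ge> 0\<close> the prefix length \<open>nat (- k)\<close> is 0: such a
  ball around a Cantor point contains the whole Cantor set.\<close>

lemma cantor_point_mem_ball: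
  assumes "agree (nat (- k)) y x"
  shows "cantor_point y \<in> laurent_ball (cantor_point x) k"
  using assms by (auto simp: mem_laurent_ball_iff fls_nth_cantor_point agree_def)

text \<open>The centre \<open>z\<close> of a covering ball may lie outside the Cantor set, so two
  Cantor points of the ball are compared instead.\<close>

lemma agree_of_mem_ball:
  assumes "(2::'a::field) \<noteq> 0"
    and "cantor_point x \<in> laurent_ball (z :: 'a fls) k" "cantor_point y \<in> laurent_ball z k"
  shows "agree (nat (- k)) x y"
  unfolding agree_def
proof (intro allI impI)
  fix i assume "i < nat (- k)"
  then have "fls_nth (cantor_point x :: 'a fls) (int i + 1) = fls_nth (cantor_point y) (int i + 1)"
    using assms(2,3) by (simp add: mem_laurent_ball_iff)
  then show "x i = y i"
    using assms(1) by (auto simp: fls_nth_cantor_point nat_add_distrib split: if_splits)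
qed

lemma laurent_of_poly_divide: "laurent_of_poly g / fls_X_inv ^ N = fls_shift (- int N) (laurent_of_poly g)"
proof -
  have "fls_shift (- int N) (laurent_of_poly g) * fls_X_inv ^ N = laurent_of_poly g"
    by (simp add: fls_X_inv_power_times_conv_shift)
  then show ?thesis by (simp add: nonzero_divide_eq_eq)
qed

text \<open>Division by \<open>X^N\<close> moves the coefficient of \<open>X^j\<close> to digit
  \<open>N - 1 - j\<close>: the digits are the coefficients in reverse order.\<close>

lemma cantor_polys_eq_words:
  "(\<lambda>g. laurent_of_poly g / fls_X_inv ^ N) ` cantor_polys N = (cantor_point ` words N :: 'a::field fls set)"
proof (intro set_eqI iffI)
  fix h :: "'a fls"
  assume "h \<in> (\<lambda>g. laurent_of_poly g / fls_X_inv ^ N) ` cantor_polys N"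
  then obtain g where h: "h = laurent_of_poly g / fls_X_inv ^ N" and g: "g \<in> cantor_polys N" by blast
  define w where "w i \<longleftrightarrow> i < N \<and> coeff g (N - 1 - i) = 2" for i
  have "h = cantor_point w"
  proof (rule fls_eqI)
    fix n :: int
    consider "n \<le> 0" | "1 \<le> n" "n \<le> N" | "n > N" by linarith
    then show "fls_nth h n = fls_nth (cantor_point w) n"
    proof cases
      case 1
      then have "coeff g (nat (int N - n)) = 0"
        using g by (cases "g = 0") (auto simp: cantor_polys_def intro!: coeff_eq_0)
      then show ?thesis
        using 1 by (simp add: h laurent_of_poly_divide fls_nth_laurent_of_poly fls_nth_cantor_point)
    next
      case 2
      then have "N - 1 - (nat n - 1) = nat (int N - n)" "nat n - 1 < N" by linarith+
      moreover have "coeff g i \<in> {0, 2}" for i using g by (simp add: cantor_polys_def)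
      ultimately show ?thesis
        using 2 by (auto simp: h laurent_of_poly_divide fls_nth_laurent_of_poly fls_nth_cantor_point w_def)
    next
      case 3
      then show ?thesis
        by (auto simp: h laurent_of_poly_divide fls_nth_laurent_of_poly fls_nth_cantor_point w_def)
    qed
  qed
  moreover have "w \<in> words N" by (simp add: words_def w_def)
  ultimately show "h \<in> cantor_point ` words N" by blast
next
  fix h :: "'a fls"
  assume "h \<in> cantor_point ` words N"
  then obtain w where h: "h = cantor_point w" and w: "w \<in> words N" by blast
  define g :: "'a poly" where "g = (\<Sum>j<N. monom (if w (N - 1 - j) then 2 else 0) j)"
  have coeff: "coeff g i = (if i < N \<and> w (N - 1 - i) then 2 else 0)" for i
    by (simp add: g_def coeff_sum sum.delta)
  have "degree g < N" if "g \<noteq> 0"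
    using that coeff[of "degree g"] by (auto split: if_splits)
  then have "g \<in> cantor_polys N" using coeff by (auto simp: cantor_polys_def)
  moreover have "laurent_of_poly g / fls_X_inv ^ N = h"
  proof (rule fls_eqI)
    fix n :: int
    consider "n \<le> 0" | "1 \<le> n" "n \<le> N" | "n > N" by linarith
    then show "fls_nth (laurent_of_poly g / fls_X_inv ^ N) n = fls_nth h n"
    proof cases
      case 2
      then have "N - 1 - nat (int N - n) = nat n - 1" "nat (int N - n) < N" by linarith+
      then show ?thesis
        using 2 by (simp add: h laurent_of_poly_divide fls_nth_laurent_of_poly fls_nth_cantor_point coeff)
    qed (use w in \<open>auto simp: h laurent_of_poly_divide fls_nth_laurent_of_poly fls_nth_cantor_point coeff words_def\<close>)
  qed
  ultimately show "h \<in> (\<lambda>g. laurent_of_poly g / fls_X_inv ^ N) ` cantor_polys N" by blast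
qed

lemma cantor_approximable_eq:
  assumes "\<And>N. N \<ge> 1 \<Longrightarrow> \<psi> (3 ^ N) = 3 powi (- r N)"
  shows "cantor_approximable \<psi> = {h \<in> cantor_set. infinite {N. N \<ge> 1 \<and>
           (\<exists>w\<in>words N. h \<in> laurent_ball (cantor_point w) (- r N))}}"
proof -
  have "(\<exists>g\<in>cantor_polys N. laurent_abs (h - laurent_of_poly g / fls_X_inv ^ N) < \<psi> (3 ^ N))
      \<longleftrightarrow> (\<exists>w\<in>words N. h \<in> laurent_ball (cantor_point w) (- r N))" if "N \<ge> 1" for N and h :: "'a fls"
    using cantor_polys_eq_words[of N, where 'a = 'a] assms[OF that]
    by (simp add: laurent_ball_def image_def set_eq_iff) metis
  then show ?thesis
    by (simp add: cantor_approximable_def cong: conj_cong)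
qed

text \<open>The approximating word is the truncation of \<open>x\<close> to \<open>N\<close> digits.
  It stays correct up to \<open>r N\<close> because \<open>x\<close> is zero on the block, which is
  empty if \<open>r N \<le> N\<close>.\<close>

lemma cantor_point_approximable:
  assumes \<psi>: "\<And>N. N \<ge> 1 \<Longrightarrow> \<psi> (3 ^ N) = 3 powi (- r N)"
    and x: "\<And>K. \<exists>N\<ge>K. \<forall>i\<in>{N..<nat (r N)}. \<not> x i"
  shows "cantor_point x \<in> cantor_approximable \<psi>"
proof -
  have "\<exists>N\<ge>K. N \<in> {N. N \<ge> 1 \<and> (\<exists>w\<in>words N. cantor_point x \<in> laurent_ball (cantor_point w) (- r N))}" for K
  proof -
    obtain N where N: "N \<ge> max 1 K" "\<forall>i\<in>{N..<nat (r N)}. \<not> x i" using x by blast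
    define w where "w i \<longleftrightarrow> i < N \<and> x i" for i
    have "w \<in> words N" by (simp add: words_def w_def)
    moreover have "agree (nat (r N)) x w" using N by (auto simp: agree_def w_def)
    then have "cantor_point x \<in> laurent_ball (cantor_point w) (- r N)" by (intro cantor_point_mem_ball) simp
    ultimately show ?thesis using N by auto
  qed
  then have "infinite {N. N \<ge> 1 \<and> (\<exists>w\<in>words N. cantor_point x \<in> laurent_ball (cantor_point w) (- r N))}"
    unfolding infinite_nat_iff_unbounded_le by blast
  then show ?thesis
    by (simp add: cantor_approximable_eq[of \<psi> r, OF \<psi>] cantor_set_eq)
qed

subsection \<open>Hausdorff measure\<close>

text \<open>Turns the cost of a cover into an integral, so that covers can be treated as
  measures.\<close>

lemma nn_integral_count_space_eq_infsum:
  fixes g :: "'i \<Rightarrow> ennreal"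
  assumes "countable A"
  shows "(\<integral>\<^sup>+ x. g x \<partial>count_space A) = infsum g A"
proof (cases "finite A")
  case True
  then show ?thesis by (simp add: nn_integral_count_space_finite)
next
  case False
  have bij: "bij_betw (from_nat_into A) UNIV A"
    using assms False by (rule bij_betw_from_nat_into)
  have "(\<integral>\<^sup>+ x. g x \<partial>count_space A) = (\<Sum>n. g (from_nat_into A n))"
    by (simp add: nn_integral_bij_count_space[OF bij, symmetric] nn_integral_count_space_nat)
  also have "\<dots> = (\<Sum>\<^sub>\<infinity>n. g (from_nat_into A n))"
    by (intro sums_unique[symmetric] has_sum_imp_sums has_sum_infsum nonneg_summable_on_complete) simp
  also have "\<dots> = infsum g A" by (rule infsum_reindex_bij_betw[OF bij, of g])
  finally show ?thesis .
qed

lemma hausdorff_premeasure_mono: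
  assumes "A \<subseteq> B"
  shows "hausdorff_premeasure f \<rho> A \<le> hausdorff_premeasure f \<rho> B"
  unfolding hausdorff_premeasure_def using assms
  by (intro INF_superset_mono) (auto simp: ball_covers_def)

lemma hausdorff_measure_mono:
  assumes "A \<subseteq> B"
  shows "hausdorff_measure f A \<le> hausdorff_measure f B"
  unfolding hausdorff_measure_eq_SUP using hausdorff_premeasure_mono[OF assms]
  by (intro SUP_mono) blast

text \<open>Number and radius are independent: \<open>k = - N\<close> covers the Cantor set,
  \<open>k = - r N\<close> gives the balls of approximation stage \<open>N\<close>.\<close>

definition cylinder_cover :: "nat \<Rightarrow> int \<Rightarrow> ('a::field fls \<times> int) set" where
  "cylinder_cover N k = (\<lambda>w. (cantor_point w, k)) ` words N"

lemma finite_cylinder_cover [simp]: "finite (cylinder_cover N k)"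
  by (simp add: cylinder_cover_def)

lemma sum_cylinder_cover_le:
  assumes "f (3 powi k) \<ge> 0"
  shows "(\<Sum>(x, j)\<in>(cylinder_cover N k :: ('a::field fls \<times> int) set). ennreal (f (3 powi j)))
      \<le> ennreal (2 ^ N * f (3 powi k))"
proof -
  have "(\<Sum>(x, j)\<in>(cylinder_cover N k :: ('a fls \<times> int) set). ennreal (f (3 powi j)))
      = (\<Sum>a\<in>(cylinder_cover N k :: ('a fls \<times> int) set). ennreal (f (3 powi k)))"
    by (intro sum.cong) (auto simp: cylinder_cover_def)
  also have "\<dots> = of_nat (card (cylinder_cover N k :: ('a fls \<times> int) set)) * ennreal (f (3 powi k))"
    by simp
  \<comment> \<open>Only an inequality, since over a field with \<open>2 = 0\<close> different words
    have the same centre.\<close>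
  also have "\<dots> \<le> of_nat (2 ^ N) * ennreal (f (3 powi k))"
    using card_image_le[OF finite_words, of _ N] card_words[of N]
    by (intro mult_right_mono of_nat_mono) (auto simp: cylinder_cover_def)
  also have "\<dots> = ennreal (2 ^ N * f (3 powi k))"
  proof -
    have "of_nat (2 ^ N) = ennreal (2 ^ N)"
      by (metis ennreal_of_nat_eq_real_of_nat of_nat_numeral of_nat_power)
    then show ?thesis using assms by (simp only: ennreal_mult zero_le_power zero_le_numeral)
  qed
  finally show ?thesis .
qed

lemma hausdorff_measure_cantor_le:
  assumes "\<And>n. n \<ge> n0 \<Longrightarrow> 0 \<le> f (3 powi - int n) \<and> 2 ^ n * f (3 powi - int n) \<le> c"
  shows "hausdorff_measure f (cantor_set :: 'a::field fls set) \<le> ennreal c"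
  unfolding hausdorff_measure_eq_SUP
proof (rule SUP_least)
  fix \<rho> :: real
  assume "\<rho> \<in> {0<..}"
  then obtain n1 where n1: "3 powi - int n1 < \<rho>" using ex_three_powi_less by auto
  \<comment> \<open>\<open>n0\<close> serves the cost bound and \<open>n1\<close> the bound on the
    radii.\<close>
  define n where "n = max n0 n1"
  let ?U = "cylinder_cover n (- int n) :: ('a fls \<times> int) set"
  have "3 powi - int n \<le> (3::real) powi - int n1" by (simp add: three_powi_le_iff n_def)
  moreover have "cantor_set \<subseteq> (\<Union>(x, k)\<in>?U. laurent_ball x k)"
  proof
    fix h :: "'a fls"
    assume "h \<in> cantor_set"
    then obtain x where h: "h = cantor_point x" by (auto simp: cantor_set_eq)
    define w where "w i \<longleftrightarrow> i < n \<and> x i" for i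
    have "h \<in> laurent_ball (cantor_point w) (- int n)"
      unfolding h by (rule cantor_point_mem_ball) (simp add: agree_def w_def)
    moreover have "w \<in> words n" by (simp add: words_def w_def)
    ultimately show "h \<in> (\<Union>(x, k)\<in>?U. laurent_ball x k)" by (auto simp: cylinder_cover_def)
  qed
  ultimately have "?U \<in> ball_covers \<rho> cantor_set"
    using n1 by (auto simp: ball_covers_def cylinder_cover_def intro: countable_finite)
  then have "hausdorff_premeasure f \<rho> (cantor_set :: 'a fls set) \<le> (\<Sum>\<^sub>\<infinity>(x, k)\<in>?U. ennreal (f (3 powi k)))"
    unfolding hausdorff_premeasure_def by (rule INF_lower)
  also have "\<dots> = (\<Sum>(x, k)\<in>?U. ennreal (f (3 powi k)))" by simp
  also have "\<dots> \<le> ennreal (2 ^ n * f (3 powi - int n))"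
    using assms[of n] by (intro sum_cylinder_cover_le) (simp add: n_def)
  also have "\<dots> \<le> ennreal c" using assms[of n] by (intro ennreal_leI) (simp add: n_def)
  finally show "hausdorff_premeasure f \<rho> (cantor_set :: 'a fls set) \<le> ennreal c" .
qed

section \<open>Covers as measures, and both estimates for the approximable set\<close>

lemma emeasure_density_count_space:
  assumes "countable A"
  shows "emeasure (density (count_space UNIV) g) A = infsum g A"
  by (simp add: emeasure_density nn_integral_count_space_eq_infsum[OF assms, symmetric]
      nn_integral_count_space_indicator)

text \<open>Subadditivity of the measure with density \<open>g\<close>; a ball may occur in several
  of the \<open>U n\<close>.\<close>

lemma infsum_UN_le:
  fixes g :: "'i \<Rightarrow> ennreal"
  assumes "\<And>n::nat. countable (U n)"
  shows "infsum g (\<Union>n. U n) \<le> (\<Sum>n. infsum g (U n))"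
  using emeasure_subadditive_countably[of U "density (count_space UNIV) g"] assms
  by (simp add: emeasure_density_count_space)

text \<open>A cover by balls of level at least \<open>n\<close> and cost below
  \<open>2 ^ n * F n\<close> would form a \<open>weighted_cover\<close> that misses an approximable
  point.\<close>

lemma hausdorff_measure_approximable_ge:
  fixes f G :: "real \<Rightarrow> real" and F :: "nat \<Rightarrow> real"
  assumes card: "CARD('a::field) = 3"
    and F: "\<And>n. 0 < F n" "antimono F" "mono (\<lambda>n. 2 ^ n * F n)"
    and F_le: "\<And>n. F n \<le> f (3 powi - int n)"
    and \<psi>: "\<And>N. N \<ge> 1 \<Longrightarrow> \<psi> (3 ^ N) = 3 powi (- r N)"
    and r: "\<And>N. N \<ge> N0 \<Longrightarrow> N < nat (r N)"
    and diverges: "\<not> summable (\<lambda>N. 2 ^ N * F (nat (r N)))"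
  shows "ennreal (2 ^ n * F n) \<le> hausdorff_measure f (cantor_approximable \<psi> :: 'a fls set)"
proof -
  let ?W = "cantor_approximable \<psi> :: 'a fls set"
  define g where "g = (\<lambda>(x :: 'a fls, k). ennreal (f (3 powi k)))"
  have "ennreal (2 ^ n * F n) \<le> infsum g U" if U: "U \<in> ball_covers (3 powi - int n) ?W" for U
  proof (rule ccontr)
    assume "\<not> ?thesis"
    then have small: "infsum g U < ennreal (2 ^ n * F n)" by simp
    \<comment> \<open>Only balls that meet the Cantor set are kept; each of them then has a Cantor
      point \<open>ctr i\<close> to stand for its centre.\<close>
    define I where "I = {i \<in> U. \<exists>x. cantor_point x \<in> laurent_ball (fst i) (snd i)}"
    define lev where "lev i = nat (- snd i)" for i :: "'a fls \<times> int"
    define ctr where "ctr i = (SOME x. cantor_point x \<in> laurent_ball (fst i) (snd i))" for i :: "'a fls \<times> int"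
    have ctr: "cantor_point (ctr i) \<in> laurent_ball (fst i) (snd i)" if "i \<in> I" for i
    proof -
      have "\<exists>x. cantor_point x \<in> laurent_ball (fst i) (snd i)" using that by (simp add: I_def)
      then show ?thesis unfolding ctr_def by (rule someI_ex)
    qed
    have radius: "snd i \<le> - int n" if "i \<in> I" for i
      using that U by (auto simp: I_def ball_covers_def three_powi_le_iff)
    have g: "F (lev i) \<le> f (3 powi snd i)" "g i = ennreal (f (3 powi snd i))" if "i \<in> I" for i
      using F_le[of "lev i"] radius[OF that] by (auto simp: lev_def g_def split: prod.splits)
    have f_pos: "0 < f (3 powi snd i)" if "i \<in> I" for i
      using F(1)[of "lev i"] g(1)[OF that] by linarith
    have "countable I"
      using U by (auto simp: I_def ball_covers_def intro: countable_subset)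
    then have "emeasure (point_measure I g) I = infsum g I"
      by (simp add: point_measure_def emeasure_density nn_integral_count_space_eq_infsum cong: infsum_cong)
    also have "\<dots> \<le> infsum g U"
      by (intro infsum_mono_neutral nonneg_summable_on_complete) (auto simp: I_def)
    finally have total: "emeasure (point_measure I g) I < ennreal (2 ^ n * F n)"
      using small by (rule le_less_trans)
    interpret M: finite_measure "point_measure I g"
      using total by (intro finite_measureI) (auto simp: space_point_measure)
    interpret weighted_cover "point_measure I g" F lev ctr
    proof
      fix i assume "i \<in> space (point_measure I g)"
      then have i: "i \<in> I" by (simp add: space_point_measure)
      then have "emeasure (point_measure I g) {i} = ennreal (f (3 powi snd i))"
        using g(2)[OF i] by (subst emeasure_point_measure_finite2) auto
      then have "measure (point_measure I g) {i} = f (3 powi snd i)"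
        using f_pos[OF i] by (simp add: measure_def)
      then show "F (lev i) \<le> measure (point_measure I g) {i}"
        using g(1)[OF i] by simp
    qed (use F in \<open>auto simp: sets_point_measure space_point_measure\<close>)
    have "measure (point_measure I g) (space (point_measure I g)) < 2 ^ n * F n"
      using total by (simp add: M.emeasure_eq_measure space_point_measure ennreal_less_iff)
    moreover have "n \<le> lev i" if "i \<in> space (point_measure I g)" for i
      using radius[of i] that by (simp add: lev_def space_point_measure)
    ultimately obtain h where h: "\<And>K. \<exists>N\<ge>K. \<forall>i\<in>{N..<nat (r N)}. \<not> h i"
      and avoid: "\<And>i. i \<in> I \<Longrightarrow> \<not> agree (lev i) h (ctr i)"
      using ex_uncovered_point[OF r diverges, of N0 n] by (simp add: space_point_measure) blast
    have "cantor_point h \<in> ?W" using \<psi> h by (rule cantor_point_approximable)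
    then obtain i where i: "i \<in> U" "cantor_point h \<in> laurent_ball (fst i) (snd i)"
      using U by (fastforce simp: ball_covers_def)
    then have "i \<in> I" by (auto simp: I_def)
    moreover have "agree (lev i) h (ctr i)"
      unfolding lev_def using two_neq_zero_of_card_eq_3[OF card] i(2) ctr[OF \<open>i \<in> I\<close>]
      by (rule agree_of_mem_ball)
    ultimately show False using avoid by blast
  qed
  then have "ennreal (2 ^ n * F n) \<le> hausdorff_premeasure f (3 powi - int n) ?W"
    unfolding hausdorff_premeasure_def g_def by (rule INF_greatest)
  also have "\<dots> \<le> hausdorff_measure f ?W"
    unfolding hausdorff_measure_eq_SUP by (rule SUP_upper) simp
  finally show ?thesis .
qed

text \<open>The Borel-Cantelli argument: an approximable point lies in balls of infinitely many
  stages, so the stages beyond any \<open>K\<close> form a cover, at the cost of a tail of the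
  series.\<close>

lemma hausdorff_measure_approximable_eq_0:
  fixes f :: "real \<Rightarrow> real"
  assumes f: "mono_on {0..} f" "f 0 = 0" and pos: "\<And>n. 0 < f (3 powi - int n)"
    and \<psi>: "\<And>N. N \<ge> 1 \<Longrightarrow> \<psi> (3 ^ N) = 3 powi (- r N)"
    and summable: "summable (\<lambda>n. 2 ^ Suc n * f (\<psi> (3 ^ Suc n)))"
  shows "hausdorff_measure f (cantor_approximable \<psi> :: 'a::field fls set) = 0"
proof -
  let ?W = "cantor_approximable \<psi> :: 'a fls set"
  define t where "t n = 2 ^ Suc n * f (\<psi> (3 ^ Suc n))" for n
  have psi: "\<psi> (3 ^ Suc n) = 3 powi - r (Suc n)" for n by (rule \<psi>) simp
  have f_nonneg: "0 \<le> f x" if "0 \<le> x" for x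
    using mono_onD[OF f(1), of 0 x] f(2) that by simp
  then have t_nonneg: "0 \<le> t n" for n by (simp add: t_def psi del: power_Suc)
  have "hausdorff_premeasure f \<rho> ?W \<le> 0" if "\<rho> > 0" for \<rho>
  proof (rule ennreal_le_epsilon)
    fix e :: real
    assume "e > 0"
    obtain j where j: "3 powi - int j < \<rho>" using ex_three_powi_less[OF \<open>\<rho> > 0\<close>] by blast
    \<comment> \<open>Smallness of the radii has to be derived: a radius above \<open>\<rho>\<close>
      would keep \<open>t n\<close> above the positive value
      \<open>f (3 powi - int j)\<close>.\<close>
    have "t \<longlonglongrightarrow> 0" using summable unfolding t_def by (rule summable_LIMSEQ_zero)
    then have "\<forall>\<^sub>F n in sequentially. t n < f (3 powi - int j)"
      using pos by (rule order_tendstoD)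
    then obtain K0 where K0: "\<And>n. n \<ge> K0 \<Longrightarrow> t n < f (3 powi - int j)"
      by (auto simp: eventually_sequentially)
    obtain K1 where K1: "\<And>n. n \<ge> K1 \<Longrightarrow> norm (\<Sum>i. t (i + n)) < e"
      using suminf_exist_split[OF \<open>e > 0\<close> summable] unfolding t_def by blast
    define K where "K = max K0 K1"
    define U :: "nat \<Rightarrow> ('a fls \<times> int) set"
      where "U n = cylinder_cover (Suc (n + K)) (- r (Suc (n + K)))" for n
    have radius: "3 powi - r (Suc n) \<le> \<rho>" if "n \<ge> K" for n
    proof (rule ccontr)
      assume "\<not> ?thesis"
      then have "f (3 powi - int j) \<le> f (\<psi> (3 ^ Suc n))"
        unfolding psi using j by (intro mono_onD[OF f(1)]) auto
      also have "\<dots> \<le> t n"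
        using mult_right_mono[of 1 "2 ^ Suc n" "f (\<psi> (3 ^ Suc n))"] f_nonneg
        by (simp add: t_def psi one_le_power del: power_Suc)
      also have "\<dots> < f (3 powi - int j)" using that by (intro K0) (simp add: K_def)
      finally show False by simp
    qed
    have "?W \<subseteq> (\<Union>(x, k)\<in>(\<Union>n. U n). laurent_ball x k)"
    proof
      fix h assume "h \<in> ?W"
      then have "infinite {N. N \<ge> 1 \<and> (\<exists>w\<in>words N. h \<in> laurent_ball (cantor_point w) (- r N))}"
        by (simp add: cantor_approximable_eq[of \<psi> r, OF \<psi>])
      then obtain N w where "N \<ge> Suc K" "w \<in> words N" "h \<in> laurent_ball (cantor_point w) (- r N)"
        unfolding infinite_nat_iff_unbounded_le by blast
      moreover from this obtain n where "N = Suc (n + K)"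
        by (metis add.commute add_Suc_right le_iff_add)
      ultimately show "h \<in> (\<Union>(x, k)\<in>(\<Union>n. U n). laurent_ball x k)"
        by (auto simp: U_def cylinder_cover_def)
    qed
    moreover have "countable (\<Union>n. U n)" unfolding U_def by (intro countable_UN countableI_type) (simp add: countable_finite)
    moreover have "\<forall>(x, k)\<in>(\<Union>n. U n). 3 powi k \<le> \<rho>"
      using radius by (auto simp: U_def cylinder_cover_def)
    ultimately have "(\<Union>n. U n) \<in> ball_covers \<rho> ?W" by (simp add: ball_covers_def)
    then have "hausdorff_premeasure f \<rho> ?W \<le> (\<Sum>\<^sub>\<infinity>(x, k)\<in>(\<Union>n. U n). ennreal (f (3 powi k)))"
      unfolding hausdorff_premeasure_def by (rule INF_lower)
    also have "\<dots> \<le> (\<Sum>n. \<Sum>\<^sub>\<infinity>(x, k)\<in>U n. ennreal (f (3 powi k)))"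
      by (intro infsum_UN_le countable_finite) (simp add: U_def)
    also have "\<dots> \<le> (\<Sum>n. ennreal (t (n + K)))"
    proof (intro suminf_le summableI)
      fix n
      show "(\<Sum>\<^sub>\<infinity>(x, k)\<in>U n. ennreal (f (3 powi k))) \<le> ennreal (t (n + K))"
        unfolding U_def t_def psi
        by (subst infsum_finite[OF finite_cylinder_cover]) (intro sum_cylinder_cover_le f_nonneg, simp)
    qed
    also have "\<dots> = ennreal (\<Sum>n. t (n + K))"
      using summable_ignore_initial_segment[OF summable, of K] t_nonneg
      by (intro suminf_ennreal2) (simp_all add: t_def)
    also have "\<dots> \<le> ennreal e"
      using K1[of K] by (intro ennreal_leI) (simp add: K_def)
    finally show "hausdorff_premeasure f \<rho> ?W \<le> 0 + ennreal e" by simp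
  qed
  then show ?thesis
    unfolding hausdorff_measure_eq_SUP by (intro antisym SUP_least) auto
qed

section \<open>The zero-full dichotomy\<close>

lemma powr_log_2_3:
  assumes "\<gamma> = ln 2 / ln 3"
  shows "(3 ^ n) powr \<gamma> = (2::real) ^ n" "(3 powi - int n) powr - \<gamma> = (2::real) ^ n"
proof -
  have "(3::real) powr \<gamma> = 2" using assms by (simp add: powr_def)
  then show *: "(3 ^ n) powr \<gamma> = (2::real) ^ n"
    using powr_powr_swap[of 3 "real n" \<gamma>] by (simp add: powr_realpow)
  show "(3 powi - int n) powr - \<gamma> = (2::real) ^ n"
    using * by (simp add: power_int_minus powr_minus inverse_powr)
qed

theorem theorem2:
  fixes \<psi> f :: "real \<Rightarrow> real" and \<gamma> :: real
  assumes "CARD('a::field) = 3"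
    and "\<gamma> = ln 2 / ln 3"
    and "\<psi> \<in> {3 ^ n | n :: nat. n \<ge> 1} \<rightarrow> {3 powi (- r) | r :: int. True}"
    and "dimension_function f"
    and "mono_on {0<..} (\<lambda>r. r powr (- \<gamma>) * f r) \<or> antimono_on {0<..} (\<lambda>r. r powr (- \<gamma>) * f r)"
  shows "((\<Sum>n. ennreal (f (\<psi> (3 ^ Suc n)) * (3 ^ Suc n) powr \<gamma>)) < \<infinity> \<longrightarrow>
            hausdorff_measure f (cantor_approximable \<psi> :: 'a fls set) = 0)
       \<and> ((\<Sum>n. ennreal (f (\<psi> (3 ^ Suc n)) * (3 ^ Suc n) powr \<gamma>)) = \<infinity> \<longrightarrow>
            hausdorff_measure f (cantor_approximable \<psi> :: 'a fls set)
              = hausdorff_measure f (cantor_set :: 'a fls set))"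
proof -
  let ?W = "cantor_approximable \<psi> :: 'a fls set"
  let ?C = "cantor_set :: 'a fls set"
  have f: "mono_on {0..} f" "f 0 = 0"
    using assms(4) by (auto simp: dimension_function_def)
  have "\<exists>k. \<psi> (3 ^ N) = 3 powi (- k)" if "N \<ge> 1" for N :: nat
    using assms(3) that by (fastforce simp: Pi_iff)
  then obtain r where \<psi>: "\<And>N. N \<ge> 1 \<Longrightarrow> \<psi> (3 ^ N) = 3 powi (- r N)" by metis
  define F where "F n = f (3 powi - int n)" for n
  define t where "t n = 2 ^ Suc n * f (\<psi> (3 ^ Suc n))" for n
  have f_nonneg: "0 \<le> f x" if "0 \<le> x" for x
    using mono_onD[OF f(1), of 0 x] f(2) that by simp
  have F_nonneg: "0 \<le> F n" for n by (simp add: F_def f_nonneg)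
  have t_nonneg: "0 \<le> t n" for n by (simp add: t_def \<psi> f_nonneg del: power_Suc)
  have F_antimono: "antimono F"
    unfolding F_def by (intro antimonoI mono_onD[OF f(1)]) (auto simp: three_powi_le_iff)
  have series: "(\<Sum>n. ennreal (f (\<psi> (3 ^ Suc n)) * (3 ^ Suc n) powr \<gamma>)) = (\<Sum>n. ennreal (t n))"
    unfolding t_def powr_log_2_3(1)[OF assms(2)] by (simp add: mult.commute)
  have W_le_C: "hausdorff_measure f ?W \<le> hausdorff_measure f ?C"
    by (rule hausdorff_measure_mono) (auto simp: cantor_approximable_def)
  have C_le: "hausdorff_measure f ?C \<le> ennreal c" if "\<And>n. n \<ge> n0 \<Longrightarrow> 2 ^ n * F n \<le> c" for c n0
    using that F_nonneg unfolding F_def by (intro hausdorff_measure_cantor_le) blast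
  show ?thesis
  proof (cases "\<exists>n. F n = 0")
    \<comment> \<open>Here \<open>f\<close> vanishes near 0, so the Cantor set already has measure
      zero and both claims hold.\<close>
    case True
    then obtain n0 where n0: "F n0 = 0" by blast
    have "F n = 0" if "n \<ge> n0" for n
      using antimonoD[OF F_antimono that] n0 F_nonneg[of n] by simp
    then have "hausdorff_measure f ?C \<le> ennreal 0" by (intro C_le[of n0]) simp
    then show ?thesis using W_le_C by simp
  next
    case False
    then have F_pos: "0 < F n" for n using F_nonneg[of n] by (simp add: less_le)
    have "hausdorff_measure f ?C \<le> hausdorff_measure f ?W" if divergent: "(\<Sum>n. ennreal (t n)) = \<infinity>"
    proof (cases "infinite {N. N \<ge> 1 \<and> r N \<le> int N}")
      case True
      \<comment> \<open>Infinitely many blocks are empty, so every point of the Cantor set is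
        approximable.\<close>
      have "cantor_point x \<in> ?W" for x
      proof (rule cantor_point_approximable[of \<psi> r, OF \<psi>])
        fix K
        obtain N where "N \<ge> K" "r N \<le> int N"
          using True unfolding infinite_nat_iff_unbounded_le by blast
        then show "\<exists>N\<ge>K. \<forall>i\<in>{N..<nat (r N)}. \<not> x i" by (intro exI[of _ N]) auto
      qed
      then show ?thesis by (intro hausdorff_measure_mono) (auto simp: cantor_set_eq)
    next
      case False
      then obtain N1 where N1: "\<And>N. N \<ge> N1 \<Longrightarrow> \<not> (N \<ge> 1 \<and> r N \<le> int N)"
        unfolding infinite_nat_iff_unbounded_le by blast
      \<comment> \<open>\<open>Suc\<close> secures \<open>N \<ge> 1\<close>; beyond
        \<open>N0\<close> all \<open>r N\<close> are positive and \<open>nat\<close> loses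
        nothing.\<close>
      define N0 where "N0 = Suc N1"
      have r: "N < nat (r N)" if "N \<ge> N0" for N
        using N1[of N] that by (simp add: N0_def)
      have t_eq: "t n = 2 ^ Suc n * F (nat (r (Suc n)))" if "n \<ge> N0" for n
      proof -
        have "0 \<le> r (Suc n)" using r[of "Suc n"] that by linarith
        then show ?thesis by (simp add: t_def F_def \<psi> del: power_Suc)
      qed
      have diverges: "\<not> summable (\<lambda>N. 2 ^ N * F (nat (r N)))"
      proof
        assume "summable (\<lambda>N. 2 ^ N * F (nat (r N)))"
        then have "summable (\<lambda>n. 2 ^ Suc n * F (nat (r (Suc n))))"
          by (subst summable_Suc_iff)
        moreover have "\<forall>\<^sub>F n in sequentially. t n = 2 ^ Suc n * F (nat (r (Suc n)))"
          using t_eq by (auto simp: eventually_sequentially)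
        ultimately have "summable t" by (simp add: summable_cong)
        then have "(\<Sum>n. ennreal (t n)) \<noteq> \<infinity>"
          using ennreal_suminf_neq_top t_nonneg unfolding infinity_ennreal_def by blast
        then show False using divergent by blast
      qed
      \<comment> \<open>The function \<open>F\<close> stays open here: the bound is used for
        \<open>F\<close> itself and for a smaller function.\<close>
      note ge = hausdorff_measure_approximable_ge[where \<psi> = \<psi> and r = r and ?N0.0 = N0, OF assms(1) _ _ _ _ \<psi> r]
      define \<phi> where "\<phi> r = r powr - \<gamma> * f r" for r
      \<comment> \<open>The radius \<open>3 powi - int n\<close> decreases in \<open>n\<close>, so
        monotonicity of \<open>\<phi>\<close> is reversed when read in \<open>n\<close>.\<close>
      have scaled: "2 ^ n * F n = \<phi> (3 powi - int n)" for n
        by (simp add: F_def \<phi>_def powr_log_2_3(2)[OF assms(2)])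
      show ?thesis
        using assms(5) unfolding \<phi>_def[symmetric]
      proof
        assume mono: "antimono_on {0<..} \<phi>"
        have "mono (\<lambda>n. 2 ^ n * F n)"
          unfolding scaled by (intro monoI monotone_onD[OF mono]) (auto simp: three_powi_le_iff)
        then have W_ge: "ennreal (2 ^ n * F n) \<le> hausdorff_measure f ?W" for n
          using F_pos F_antimono diverges by (intro ge) (simp_all add: F_def[symmetric])
        show ?thesis
        \<comment> \<open>A finite measure \<open>c\<close> of \<open>?W\<close> bounds all
          \<open>2 ^ n * F n\<close> and thus the measure of the Cantor set; if it is infinite,
          nothing remains to be shown.\<close>
        proof (cases "hausdorff_measure f ?W")
          case (real c)
          then have "2 ^ n * F n \<le> c" for n using W_ge[of n] by (simp add: ennreal_le_iff)
          then show ?thesis using C_le[of 0 c] real by simp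
        qed simp
      next
        assume mono: "mono_on {0<..} \<phi>"
        have dec: "decseq (\<lambda>n. 2 ^ n * F n)"
          unfolding scaled by (intro antimonoI monotone_onD[OF mono]) (auto simp: three_powi_le_iff)
        obtain c where lim: "(\<lambda>n. 2 ^ n * F n) \<longlonglongrightarrow> c" and c_le: "\<forall>n. c \<le> 2 ^ n * F n"
          by (rule decseq_convergent[OF dec, of 0]) (simp_all add: F_nonneg)
        have "0 \<le> c" using F_nonneg by (intro LIMSEQ_le_const[OF lim]) simp
        have "hausdorff_measure f ?C \<le> ennreal c"
        proof (rule ennreal_le_epsilon)
          fix e :: real
          assume "e > 0"
          then have "\<forall>\<^sub>F n in sequentially. 2 ^ n * F n < c + e"
            by (intro order_tendstoD(2)[OF lim]) simp
          then obtain n0 where "\<And>n. n \<ge> n0 \<Longrightarrow> 2 ^ n * F n < c + e"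
            by (auto simp: eventually_sequentially)
          then have "hausdorff_measure f ?C \<le> ennreal (c + e)"
            by (intro C_le[of n0] less_imp_le)
          then show "hausdorff_measure f ?C \<le> ennreal c + ennreal e"
            using \<open>0 \<le> c\<close> \<open>e > 0\<close> by simp
        qed
        also have "ennreal c \<le> hausdorff_measure f ?W"
        proof (cases "c = 0")
          case False
          then have "c > 0" using \<open>0 \<le> c\<close> by simp
          \<comment> \<open>\<open>2 ^ n * G n\<close> is the constant \<open>c\<close>, hence
            monotone, and lies below \<open>2 ^ n * F n\<close>.\<close>
          define G where "G n = c / 2 ^ n" for n :: nat
          \<comment> \<open>As \<open>2 ^ n * F n\<close> decreases from \<open>F 0\<close>,
            \<open>F\<close> is at most \<open>F 0 / c\<close> times \<open>G\<close>, and
            divergence passes to \<open>G\<close> by comparison.\<close>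
          have "\<not> summable (\<lambda>N. 2 ^ N * G (nat (r N)))"
          proof
            assume "summable (\<lambda>N. 2 ^ N * G (nat (r N)))"
            then have "summable (\<lambda>N. F 0 / c * (2 ^ N * G (nat (r N))))"
              by (rule summable_mult)
            moreover have "norm (2 ^ N * F (nat (r N))) \<le> F 0 / c * (2 ^ N * G (nat (r N)))" for N
            proof -
              have "2 ^ nat (r N) * F (nat (r N)) \<le> F 0" using decseqD[OF dec, of 0] by simp
              then show ?thesis
                using F_nonneg \<open>c > 0\<close> by (simp add: G_def field_simps abs_mult)
            qed
            ultimately have "summable (\<lambda>N. 2 ^ N * F (nat (r N)))"
              by (rule summable_comparison_test'[where N = 0])
            then show False using diverges by blast
          qed
          moreover have G: "0 < G n" "mono (\<lambda>n. 2 ^ n * G n)" for n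
            using \<open>c > 0\<close> by (auto simp: G_def mono_def)
          moreover have "antimono G"
            using \<open>c > 0\<close> by (auto simp: antimono_def G_def intro!: divide_left_mono)
          moreover have "G n \<le> F n" for n using spec[OF c_le, of n] by (simp add: G_def field_simps)
          ultimately have "ennreal (2 ^ 0 * G 0) \<le> hausdorff_measure f ?W"
            using G by (intro ge) (simp_all add: F_def[symmetric])
          then show ?thesis by (simp add: G_def)
        qed simp
        finally show ?thesis .
      qed
    qed
    moreover have "hausdorff_measure f ?W = 0" if "(\<Sum>n. ennreal (t n)) < \<infinity>"
    proof -
      have "summable t" using that t_nonneg by (intro summable_suminf_not_top) auto
      then show ?thesis
        using F_pos unfolding t_def F_def by (intro hausdorff_measure_approximable_eq_0[of f \<psi> r, OF f _ \<psi>])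
    qed
    ultimately show ?thesis unfolding series using W_le_C by (auto intro: antisym)
  qed
qed

end
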